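(* Let $\lambda\in\mathbb{R}$, $\lambda\ne 0$, let $r\ge 0$ be an integer, and let $p\in\mathbb{Z}$. For every integer $n\ge 0$, $$\frac{(-\lambda)^{n}(1)_{n+1,1/\lambda}}{(n+1)^{p}}=\sum_{k=0}^{n}{n+r \brack k+r}_{r,\lambda}\beta_{k,\lambda}^{(p)}(-r).$$
   Context: For a real number $\mu$ put $(x)_{0,\mu}=1$, $(x)_{n,\mu}=x(x-\mu)\cdots(x-(n-1)\mu)$ and $\langle x\rangle_{0,\mu}=1$, $\langle x\rangle_{n,\mu}=x(x+\mu)\cdots(x+(n-1)\mu)$ for $n\ge 1$; these are used with $\mu=\lambda$ and $\mu=1/\lambda$. Also $\langle x\rangle_0=1$ and $\langle x\rangle_n=x(x+1)\cdots(x+n-1)$ for $n\ge1$. For an integer $r\ge 0$, the unsigned degenerate $r$-Stirling numbers of the first kind ${n+r \brack k+r}_{r,\lambda}$ ($0\le k\le n$) are defined by the polynomial identity in $x$: $\langle x+r\rangle_{n}=\sum_{k=0}^{n}{n+r \brack k+r}_{r,\lambda}\langle x\rangle_{k,\lambda}$ for $n\ge 0$. The degenerate exponential functions are the formal power series $e_{\lambda}^{x}(t)=\sum_{n=0}^{\infty}(x)_{n,\lambda}\frac{t^{n}}{n!}$, with $e_\lambda(t)=e_\lambda^1(t)$. For $p\in\mathbb{Z}$ the degenerate polylogarithm function of index $p$ is the formal power series $$\mathrm{Li}_{p,\lambda}(x)=\sum_{n=1}^{\infty}\frac{(-\lambda)^{n-1}(1)_{n,1/\lambda}}{(n-1)!\,n^{p}}x^{n},$$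 and the degenerate poly-Bernoulli polynomials $\beta^{(p)}_{n,\lambda}(x)$ of index $p$ are defined by the formal power series identity $$\frac{\mathrm{Li}_{p,\lambda}(1-e_{\lambda}(-t))}{1-e_{\lambda}(-t)}e_{\lambda}^{-x}(-t)=\sum_{n=0}^{\infty}\beta_{n,\lambda}^{(p)}(x)\frac{t^{n}}{n!}.$$ *)

theory Defs
  imports Complex_Main "HOL-Computational_Algebra.Computational_Algebra"
begin

definition deg_falling :: "real \<Rightarrow> real \<Rightarrow> nat \<Rightarrow> real" where
  "deg_falling \<mu> x n = (\<Prod>i<n. x - real i * \<mu>)"

definition deg_rising :: "real \<Rightarrow> real \<Rightarrow> nat \<Rightarrow> real" where
  "deg_rising \<mu> x n = (\<Prod>i<n. x + real i * \<mu>)"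

text \<open>
  The value of \<open>deg_r_stirling1 lam r n k\<close> is the number with upper index \<open>n + r\<close> and lower index
  \<open>k + r\<close>; both shifts by \<open>r\<close> are built in. The coefficient sequence is made unique by letting it
  vanish beyond \<open>n\<close>, see \<open>deg_r_stirling1_ex1\<close> below.
\<close>

definition deg_r_stirling1 :: "real \<Rightarrow> nat \<Rightarrow> nat \<Rightarrow> nat \<Rightarrow> real" where
  "deg_r_stirling1 lam r n =
     (THE c. (\<forall>k>n. c k = 0) \<and>
             (\<forall>x::real. pochhammer (x + real r) n = (\<Sum>k\<le>n. c k * deg_rising lam x k)))"

lemma deg_rising_expansion_unique:
  assumes "\<forall>x::real. (\<Sum>k\<le>n. d k * deg_rising lam x k) = 0"
  shows "\<forall>k\<le>n. d k = 0"
  using assms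
proof (induction n)
  case 0
  then show ?case by (simp add: deg_rising_def)
next
  case (Suc n)
  define P where "P k = (\<Prod>i<k. [:real i * lam, 1:])" for k :: nat
  have poly_P: "poly (P k) x = deg_rising lam x k" for k x
    by (simp add: P_def deg_rising_def poly_prod add.commute)
  have deg_P: "degree (P k) = k" for k
    unfolding P_def by (subst degree_prod_eq_sum_degree) auto
  have lead_P: "coeff (P k) k = 1" for k
  proof -
    have "lead_coeff (P k) = 1"
      unfolding P_def by (simp add: lead_coeff_prod)
    then show ?thesis by (simp add: deg_P)
  qed
  have "poly (\<Sum>k\<le>Suc n. smult (d k) (P k)) x = 0" for x
    using Suc.prems by (simp add: poly_sum poly_P)
  then have zero: "(\<Sum>k\<le>Suc n. smult (d k) (P k)) = 0"
    using poly_all_0_iff_0 by blast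
  have "coeff (P k) (Suc n) = 0" if "k \<le> n" for k
    using that by (intro coeff_eq_0) (simp add: deg_P)
  then have "coeff (\<Sum>k\<le>Suc n. smult (d k) (P k)) (Suc n) = d (Suc n)"
    by (simp add: coeff_sum lead_P)
  with zero have "d (Suc n) = 0" by simp
  with Suc show ?case by (auto simp: le_Suc_eq)
qed

lemma deg_rising_expansion_exists:
  "\<exists>c. (\<forall>k>n. c k = 0) \<and>
       (\<forall>x::real. pochhammer (x + real r) n = (\<Sum>k\<le>n. c k * deg_rising lam x k))"
proof (induction n)
  case 0
  show ?case by (rule exI[of _ "\<lambda>k. if k = 0 then 1 else 0"]) (simp add: deg_rising_def)
next
  case (Suc n)
  then obtain c where c0: "\<And>k. k > n \<Longrightarrow> c k = 0"
    and c: "\<And>x::real. pochhammer (x + real r) n = (\<Sum>k\<le>n. c k * deg_rising lam x k)"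
    by blast
  define c' where
    "c' k = (if k = 0 then 0 else c (k - 1)) + (real (n + r) - real k * lam) * c k" for k
  have "pochhammer (x + real r) (Suc n) = (\<Sum>k\<le>Suc n. c' k * deg_rising lam x k)" for x
  proof -
    have step: "c k * deg_rising lam x k * (x + real (n + r)) =
        c k * deg_rising lam x (Suc k) + (real (n + r) - real k * lam) * c k * deg_rising lam x k" for k
      by (simp add: deg_rising_def algebra_simps)
    have "pochhammer (x + real r) (Suc n) = (\<Sum>k\<le>n. c k * deg_rising lam x k * (x + real (n + r)))"
      by (simp add: pochhammer_Suc c sum_distrib_right add_ac)
    also have "\<dots> = (\<Sum>k\<le>n. c k * deg_rising lam x (Suc k))
        + (\<Sum>k\<le>n. (real (n + r) - real k * lam) * c k * deg_rising lam x k)"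
      by (simp only: step sum.distrib)
    also have "(\<Sum>k\<le>n. c k * deg_rising lam x (Suc k)) =
        (\<Sum>k\<le>Suc n. (if k = 0 then 0 else c (k - 1)) * deg_rising lam x k)"
      by (simp only: sum.atMost_Suc_shift) simp
    also have "(\<Sum>k\<le>n. (real (n + r) - real k * lam) * c k * deg_rising lam x k) =
        (\<Sum>k\<le>Suc n. (real (n + r) - real k * lam) * c k * deg_rising lam x k)"
      by (simp add: c0)
    finally show ?thesis
      by (simp only: c'_def distrib_right sum.distrib)
  qed
  moreover have "\<forall>k>Suc n. c' k = 0" by (simp add: c'_def c0)
  ultimately show ?case by blast
qed

lemma deg_r_stirling1_ex1:
  "\<exists>!c. (\<forall>k>n. c k = 0) \<and>
        (\<forall>x::real. pochhammer (x + real r) n = (\<Sum>k\<le>n. c k * deg_rising lam x k))"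
proof (rule ex_ex1I[OF deg_rising_expansion_exists])
  fix c d :: "nat \<Rightarrow> real"
  assume c: "(\<forall>k>n. c k = 0) \<and>
      (\<forall>x::real. pochhammer (x + real r) n = (\<Sum>k\<le>n. c k * deg_rising lam x k))"
    and d: "(\<forall>k>n. d k = 0) \<and>
      (\<forall>x::real. pochhammer (x + real r) n = (\<Sum>k\<le>n. d k * deg_rising lam x k))"
  have "\<forall>x::real. (\<Sum>k\<le>n. (c k - d k) * deg_rising lam x k) = 0"
    using c d by (simp add: left_diff_distrib sum_subtractf)
  from deg_rising_expansion_unique[OF this] have "c k = d k" if "k \<le> n" for k
    using that by simp
  moreover have "c k = d k" if "k > n" for k using that c d by simp
  ultimately show "c = d" by (metis ext not_le)
qed

lemma pochhammer_eq_deg_r_stirling1: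
  "pochhammer (x + real r) n = (\<Sum>k\<le>n. deg_r_stirling1 lam r n k * deg_rising lam x k)"
  using theI'[OF deg_r_stirling1_ex1[of n r lam]] unfolding deg_r_stirling1_def by blast

definition deg_exp :: "real \<Rightarrow> real \<Rightarrow> real fps" where
  "deg_exp lam x = Abs_fps (\<lambda>n. deg_falling lam x n / fact n)"

definition deg_polylog :: "int \<Rightarrow> real \<Rightarrow> real fps" where
  "deg_polylog p lam = Abs_fps (\<lambda>n. if n = 0 then 0
     else (-lam) ^ (n - 1) * deg_falling (1 / lam) 1 n / (fact (n - 1) * real n powi p))"

text \<open>
  The argument \<open>-t\<close> is rendered as composition with \<open>- fps_X\<close>. The series
  \<open>one_minus_deg_exp lam\<close> is \<open>1 - e(-t)\<close>; it starts with \<open>t\<close>, so that composing with it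
  is legitimate and the division in \<open>deg_poly_bernoulli_gf\<close> is exact.
\<close>

definition one_minus_deg_exp :: "real \<Rightarrow> real fps" where
  "one_minus_deg_exp lam = 1 - (deg_exp lam 1 oo (- fps_X))"

definition deg_poly_bernoulli_gf :: "int \<Rightarrow> real \<Rightarrow> real \<Rightarrow> real fps" where
  "deg_poly_bernoulli_gf p lam x =
     (deg_polylog p lam oo one_minus_deg_exp lam) / one_minus_deg_exp lam
       * (deg_exp lam (- x) oo (- fps_X))"

definition deg_poly_bernoulli :: "int \<Rightarrow> real \<Rightarrow> nat \<Rightarrow> real \<Rightarrow> real" where
  "deg_poly_bernoulli p lam n x = fact n * fps_nth (deg_poly_bernoulli_gf p lam x) n"

lemma deg_poly_bernoulli_egf:
  "deg_poly_bernoulli_gf p lam x = Abs_fps (\<lambda>n. deg_poly_bernoulli p lam n x / fact n)"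
  by (simp add: deg_poly_bernoulli_def fps_eq_iff)

lemma one_minus_deg_exp_nth_0: "fps_nth (one_minus_deg_exp lam) 0 = 0"
  by (simp add: one_minus_deg_exp_def deg_exp_def deg_falling_def)

lemma one_minus_deg_exp_nth_1: "fps_nth (one_minus_deg_exp lam) 1 = 1"
  by (simp add: one_minus_deg_exp_def deg_exp_def deg_falling_def fps_compose_nth)

lemma one_minus_deg_exp_dvd: "one_minus_deg_exp lam dvd (deg_polylog p lam oo one_minus_deg_exp lam)"
proof -
  let ?u = "one_minus_deg_exp lam"
  let ?g = "deg_polylog p lam oo ?u"
  have u0: "?u \<noteq> 0" using one_minus_deg_exp_nth_1[of lam] by force
  have "subdegree ?u = 1"
    by (rule subdegreeI) (use one_minus_deg_exp_nth_0 one_minus_deg_exp_nth_1 in auto)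
  moreover have "?g = 0 \<or> subdegree ?g \<ge> 1"
  proof -
    have "fps_nth ?g 0 = 0" by (simp add: deg_polylog_def)
    then show ?thesis by (metis less_one not_le nth_subdegree_nonzero)
  qed
  ultimately show ?thesis using u0 by (cases "?g = 0") (simp_all add: fps_dvd_iff)
qed

end

theory Submission
  imports Defs
begin

text \<open>
  Write \<open>u = 1 - e(-t)\<close>, where \<open>e(t)\<close> is the degenerate exponential, so that
  \<open>e\<^sup>r(-t) = (1 - u)\<^sup>r\<close>. For fixed \<open>n\<close> and \<open>r\<close>, weighting exponential coefficients with
  degenerate Stirling numbers gives a linear functional
  \<open>L(f) = (\<Sum>k\<le>n. S(n, k) * k! * [t\<^sup>k] f)\<close> on power series. It
  undoes the substitution \<open>w = u(t)\<close> that defines the poly-Bernoulli polynomials: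
  \<open>L (F(u) * e\<^sup>r(-t)) = n! * [w\<^sup>n] F(w)\<close> for every power series \<open>F\<close>
  (lemma \<open>stirling_functional_compose\<close>). The theorem is the case where
  \<open>F(w)\<close> is the polylogarithm divided by \<open>w\<close>.

  To see this inversion, note that \<open>k! * [t\<^sup>k] e\<^sup>y(-t)\<close> is the degenerate rising
  factorial of \<open>-y\<close>, hence by the defining identity of the Stirling numbers \<open>L\<close> sends
  \<open>e\<^sup>y(-t)\<close> to the ordinary rising factorial of length \<open>n\<close> starting at \<open>r - y\<close>
  (lemma \<open>stirling_functional_deg_exp\<close>). For \<open>y = r + j\<close> this value is
  \<open>n! * [w\<^sup>n] (1 - w)\<^sup>j\<close>, which is the claim for \<open>F(w) = (1 - w)\<^sup>j\<close>. The powers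
  of \<open>1 - w\<close> span the polynomials, so the claim holds for each monomial \<open>w\<^sup>m\<close>, and then
  for all power series, because only coefficients up to \<open>n\<close> matter.
\<close>

text \<open>
  As formal series, \<open>e\<^sup>x(t) = (1 + lam * t) powr (x / lam)\<close>; through the binomial series
  this yields the exponent law.
\<close>

lemma deg_exp_eq_fps_binomial:
  assumes "lam \<noteq> 0"
  shows "deg_exp lam x = fps_binomial (x / lam) oo (fps_const lam * fps_X)"
proof (rule fps_ext)
  fix n
  have "deg_falling lam x n = (\<Prod>i<n. lam * (x / lam - real i))"
    unfolding deg_falling_def using assms by (intro prod.cong) (auto simp: field_simps)
  also have "\<dots> = lam ^ n * (fact n * ((x / lam) gchoose n))"
    by (simp add: prod.distrib gbinomial_mult_fact lessThan_atLeast0)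
  finally show "deg_exp lam x $ n = (fps_binomial (x / lam) oo (fps_const lam * fps_X)) $ n"
    by (simp add: deg_exp_def)
qed

lemma deg_exp_of_nat:
  assumes "lam \<noteq> 0"
  shows "deg_exp lam (real j) = deg_exp lam 1 ^ j"
  by (simp add: deg_exp_eq_fps_binomial[OF assms] fps_compose_power fps_binomial_power)

lemma deg_exp_of_nat_neg_arg:
  assumes "lam \<noteq> 0"
  shows "deg_exp lam (real j) oo (- fps_X) = (1 - one_minus_deg_exp lam) ^ j"
  by (simp add: one_minus_deg_exp_def deg_exp_of_nat[OF assms] fps_compose_power)

lemma fact_mult_deg_exp_neg_arg_nth:
  "fact k * (deg_exp lam y oo (- fps_X)) $ k = deg_rising lam (- y) k"
proof -
  have "(-1) ^ k * deg_falling lam y k = (\<Prod>i<k. (-1) * (y - real i * lam))"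
    unfolding deg_falling_def by (subst prod.distrib) simp
  also have "\<dots> = deg_rising lam (- y) k"
    unfolding deg_rising_def by (intro prod.cong) auto
  finally show ?thesis
    by (simp add: fps_compose_uminus' deg_exp_def)
qed

definition stirling_functional :: "real \<Rightarrow> nat \<Rightarrow> nat \<Rightarrow> real fps \<Rightarrow> real" where
  "stirling_functional lam r n f = (\<Sum>k\<le>n. deg_r_stirling1 lam r n k * (fact k * f $ k))"

lemma stirling_functional_sum_const_mult:
  "stirling_functional lam r n (\<Sum>i\<in>A. fps_const (c i) * f i) =
     (\<Sum>i\<in>A. c i * stirling_functional lam r n (f i))"
proof -
  have "stirling_functional lam r n (\<Sum>i\<in>A. fps_const (c i) * f i) =
      (\<Sum>k\<le>n. \<Sum>i\<in>A. c i * (deg_r_stirling1 lam r n k * (fact k * f i $ k)))"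
    by (simp add: stirling_functional_def fps_sum_nth sum_distrib_left mult_ac)
  also have "\<dots> = (\<Sum>i\<in>A. c i * stirling_functional lam r n (f i))"
    by (subst sum.swap) (simp add: stirling_functional_def sum_distrib_left)
  finally show ?thesis .
qed

text \<open>
  The series \<open>e\<^sup>y(-t)\<close> generates the degenerate rising factorials of \<open>-y\<close>, which are exactly
  the basis in which the Stirling numbers expand the ordinary rising factorial.
\<close>

lemma stirling_functional_deg_exp:
  "stirling_functional lam r n (deg_exp lam y oo (- fps_X)) = pochhammer (real r - y) n"
  using pochhammer_eq_deg_r_stirling1[of "- y" r n lam]
  by (simp add: stirling_functional_def fact_mult_deg_exp_neg_arg_nth)

lemma one_minus_fps_X_power_nth:
  "((1 - fps_X) ^ j :: real fps) $ n = pochhammer (- real j) n / fact n"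
proof -
  have "(1 - fps_X) ^ j = fps_binomial (real j) oo (- fps_X)"
    using one_minus_const_fps_X_power[of "1::real" j] by simp
  then show ?thesis
    by (simp add: fps_compose_uminus' gbinomial_pochhammer flip: power_mult_distrib mult.assoc)
qed

lemma stirling_functional_shifted_power:
  assumes "lam \<noteq> 0"
  shows "stirling_functional lam r n
           ((1 - one_minus_deg_exp lam) ^ j * (deg_exp lam (real r) oo (- fps_X))) =
         fact n * ((1 - fps_X) ^ j :: real fps) $ n"
proof -
  have "(1 - one_minus_deg_exp lam) ^ j * (deg_exp lam (real r) oo (- fps_X)) =
      deg_exp lam (real (r + j)) oo (- fps_X)"
    unfolding deg_exp_of_nat_neg_arg[OF assms] by (simp add: power_add mult.commute)
  then show ?thesis
    by (simp add: stirling_functional_deg_exp one_minus_fps_X_power_nth)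
qed

text \<open>
  Both \<open>u\<^sup>m = (1 - (1 - u))\<^sup>m\<close> and \<open>w\<^sup>m = (1 - (1 - w))\<^sup>m\<close> have the same binomial
  coefficients as combinations of the powers of \<open>1 - u\<close> and \<open>1 - w\<close>, and for those powers
  the identity is already known.
\<close>

lemma stirling_functional_power:
  assumes "lam \<noteq> 0"
  shows "stirling_functional lam r n
           (one_minus_deg_exp lam ^ m * (deg_exp lam (real r) oo (- fps_X))) =
         (if n = m then fact n else 0)"
proof -
  define u where "u = one_minus_deg_exp lam"
  define V where "V = deg_exp lam (real r) oo (- fps_X)"
  define b where "b j = real (m choose j) * (-1) ^ j" for j
  have expand: "w ^ m = (\<Sum>j\<le>m. fps_const (b j) * (1 - w) ^ j)" for w :: "real fps"
  proof -
    have const_b: "fps_const (b j) = of_nat (m choose j) * (-1) ^ j" for j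
      unfolding b_def
      by (simp add: fps_of_nat flip: fps_const_mult fps_const_power fps_const_neg)
    have "w ^ m = (- (1 - w) + 1) ^ m" by simp
    also have "\<dots> = (\<Sum>j\<le>m. of_nat (m choose j) * (- (1 - w)) ^ j)"
      by (subst binomial_ring) simp
    also have "\<dots> = (\<Sum>j\<le>m. fps_const (b j) * (1 - w) ^ j)"
      by (intro sum.cong refl) (subst power_minus, simp add: const_b mult.assoc)
    finally show ?thesis .
  qed
  have "stirling_functional lam r n (u ^ m * V) =
      stirling_functional lam r n (\<Sum>j\<le>m. fps_const (b j) * ((1 - u) ^ j * V))"
    unfolding expand[of u] by (simp add: sum_distrib_right mult.assoc)
  also have "\<dots> = (\<Sum>j\<le>m. b j * (fact n * ((1 - fps_X) ^ j :: real fps) $ n))"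
    unfolding stirling_functional_sum_const_mult u_def V_def
    by (simp only: stirling_functional_shifted_power[OF assms])
  also have "\<dots> = fact n * (\<Sum>j\<le>m. fps_const (b j) * (1 - fps_X) ^ j) $ n"
    by (simp add: fps_sum_nth sum_distrib_left mult_ac)
  also have "\<dots> = fact n * (fps_X ^ m :: real fps) $ n"
    by (simp only: expand[of fps_X])
  finally show ?thesis
    by (simp add: u_def V_def)
qed

text \<open>
  Since \<open>u\<^sup>m\<close> has no terms below \<open>t\<^sup>m\<close>, replacing \<open>F\<close> by its truncation at degree \<open>n\<close>
  does not change the coefficients that the functional reads.
\<close>

lemma stirling_functional_compose:
  assumes "lam \<noteq> 0"
  shows "stirling_functional lam r n
           ((F oo one_minus_deg_exp lam) * (deg_exp lam (real r) oo (- fps_X))) =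
         fact n * F $ n"
proof -
  define u where "u = one_minus_deg_exp lam"
  define V where "V = deg_exp lam (real r) oo (- fps_X)"
  have u0: "u $ 0 = 0" by (simp add: u_def one_minus_deg_exp_nth_0)
  have trunc: "(F oo u) $ i = (\<Sum>m\<le>n. fps_const (F $ m) * u ^ m) $ i" if "i \<le> n" for i
  proof -
    have "(\<Sum>m\<le>n. F $ m * (u ^ m) $ i) = (\<Sum>m=0..i. F $ m * (u ^ m) $ i)"
      using that startsby_zero_power_prefix[OF u0]
      by (intro sum.mono_neutral_right) auto
    then show ?thesis by (simp add: fps_compose_nth fps_sum_nth)
  qed
  have "((F oo u) * V) $ k = (\<Sum>m\<le>n. fps_const (F $ m) * (u ^ m * V)) $ k" if "k \<le> n" for k
  proof -
    have "((F oo u) * V) $ k = ((\<Sum>m\<le>n. fps_const (F $ m) * u ^ m) * V) $ k"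
      unfolding fps_mult_nth using that by (intro sum.cong refl) (simp add: trunc)
    then show ?thesis by (simp add: sum_distrib_right mult.assoc)
  qed
  then have "stirling_functional lam r n ((F oo u) * V) =
      stirling_functional lam r n (\<Sum>m\<le>n. fps_const (F $ m) * (u ^ m * V))"
    by (simp add: stirling_functional_def)
  also have "\<dots> = (\<Sum>m\<le>n. F $ m * (if n = m then fact n else 0))"
    unfolding stirling_functional_sum_const_mult u_def V_def
    by (simp only: stirling_functional_power[OF assms])
  also have "\<dots> = fact n * F $ n"
    by (simp add: if_distrib cong: if_cong)
  finally show ?thesis by (simp add: u_def V_def)
qed

text \<open>
  Cancelling \<open>w\<close> from the polylogarithm before substituting \<open>w = u(t)\<close> turns the quotient in
  the generating function into a composition, the form that the functional can evaluate.
\<close>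

lemma deg_poly_bernoulli_gf_eq_compose:
  "deg_poly_bernoulli_gf p lam x =
     (fps_shift 1 (deg_polylog p lam) oo one_minus_deg_exp lam) * (deg_exp lam (- x) oo (- fps_X))"
proof -
  define u where "u = one_minus_deg_exp lam"
  have u0: "u $ 0 = 0" by (simp add: u_def one_minus_deg_exp_nth_0)
  have "u \<noteq> 0"
    using one_minus_deg_exp_nth_1[of lam] by (auto simp: u_def)
  have "deg_polylog p lam = fps_shift 1 (deg_polylog p lam) * fps_X"
    by (rule fps_ext) (simp add: deg_polylog_def)
  then have "deg_polylog p lam oo u = (fps_shift 1 (deg_polylog p lam) oo u) * u"
    by (metis fps_compose_mult_distrib[OF u0] fps_X_fps_compose_startby0[OF u0])
  then show ?thesis
    using \<open>u \<noteq> 0\<close> by (simp add: deg_poly_bernoulli_gf_def u_def)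
qed

theorem theorem7:
  fixes lam :: real and r n :: nat and p :: int
  assumes "lam \<noteq> 0"
  shows "(-lam) ^ n * deg_falling (1 / lam) 1 (n + 1) / (real (n + 1) powi p) =
    (\<Sum>k=0..n. deg_r_stirling1 lam r n k * deg_poly_bernoulli p lam k (- real r))"
proof -
  have "(\<Sum>k=0..n. deg_r_stirling1 lam r n k * deg_poly_bernoulli p lam k (- real r)) =
      stirling_functional lam r n (deg_poly_bernoulli_gf p lam (- real r))"
    by (simp add: stirling_functional_def deg_poly_bernoulli_def atMost_atLeast0)
  also have "\<dots> = fact n * fps_shift 1 (deg_polylog p lam) $ n"
    using stirling_functional_compose[OF assms]
    by (simp add: deg_poly_bernoulli_gf_eq_compose)
  also have "\<dots> = (-lam) ^ n * deg_falling (1 / lam) 1 (n + 1) / (real (n + 1) powi p)"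
    by (simp add: deg_polylog_def)
  finally show ?thesis by (rule sym)
qed

end
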